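(* Let $X$ be a real Banach space with $\dim X\geqslant 2$. Then for every $t\in[0,\frac12)$, $$L_X(t)=\tfrac12\,\gamma_X(1-2t).$$
   Context: For $x,y$ in a real Banach space $X$, isosceles orthogonality $x\perp_I y$ means $\|x+y\|=\|x-y\|$. For $0\leqslant t<\frac12$ define $$L_X(t)=\sup\left\{\frac{\|tx+(1-t)y\|^2+\|(1-t)x+ty\|^2}{\|x+y\|^2}: x,y\in X,\ (x,y)\neq(0,0),\ x\perp_I y\right\}.$$ Let $S_X=\{x\in X:\|x\|=1\}$. For $s\in[0,1]$ define $$\gamma_X(s)=\sup\left\{\frac{\|x+sy\|^2+\|x-sy\|^2}{2}: x,y\in S_X\right\}.$$ *)

theory Defs
  imports Complex_Main
begin

definition isosceles_orthogonal :: "'a::real_normed_vector \<Rightarrow> 'a \<Rightarrow> bool"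
    (infix "\<bottom>\<^sub>I" 50)
  where "x \<bottom>\<^sub>I y \<longleftrightarrow> norm (x + y) = norm (x - y)"

text \<open>
  The space is passed as a type token. The suprema are taken in the reals: on a nontrivial
  space both sets are nonempty and, for the intended parameter ranges, bounded above. In
  \<open>L_const\<close> the denominator does not vanish, because \<open>x + y = 0\<close> and \<open>x \<bottom>\<^sub>I y\<close>
  force \<open>x = y = 0\<close>.
\<close>

definition L_const :: "'a::real_normed_vector itself \<Rightarrow> real \<Rightarrow> real"
  where "L_const X t =
    Sup {((norm (t *\<^sub>R x + (1 - t) *\<^sub>R y))\<^sup>2 + (norm ((1 - t) *\<^sub>R x + t *\<^sub>R y))\<^sup>2)
            / (norm (x + y))\<^sup>2
          | x y :: 'a. (x, y) \<noteq> (0, 0) \<and> x \<bottom>\<^sub>I y}"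

definition gamma_const :: "'a::real_normed_vector itself \<Rightarrow> real \<Rightarrow> real"
  where "gamma_const X s =
    Sup {((norm (x + s *\<^sub>R y))\<^sup>2 + (norm (x - s *\<^sub>R y))\<^sup>2) / 2
          | x y :: 'a. norm x = 1 \<and> norm y = 1}"

end

theory Submission imports Defs begin

text \<open>
  Put \<open>u = x + y\<close> and \<open>v = x - y\<close>. Then \<open>x \<bottom>\<^sub>I y\<close> says that \<open>u\<close> and \<open>v\<close> have equal norm, and
  with \<open>s = 1 - 2 t\<close> the two combinations of \<open>x\<close> and \<open>y\<close> are \<open>(u - s v) / 2\<close> and
  \<open>(u + s v) / 2\<close>. Normalising \<open>u\<close> and \<open>v\<close> therefore shows that the set defining \<open>L_const\<close> is
  exactly one half of the set defining \<open>gamma_const\<close>.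
\<close>

text \<open>The triangle inequality bounds both norms by \<open>1 + \<bar>s\<bar>\<close>.
  Boundedness is what allows \<open>Sup\<close> to be exchanged with scaling at the end.\<close>

lemma bdd_above_gamma_set:
  fixes s :: real
  shows "bdd_above {((norm (x + s *\<^sub>R y))\<^sup>2 + (norm (x - s *\<^sub>R y))\<^sup>2) / 2
          | x y :: 'a::real_normed_vector. norm x = 1 \<and> norm y = 1}"
proof (rule bdd_aboveI, clarify)
  fix x y :: 'a
  assume "norm x = 1" "norm y = 1"
  then have "norm (x + s *\<^sub>R y) \<le> 1 + \<bar>s\<bar>" "norm (x - s *\<^sub>R y) \<le> 1 + \<bar>s\<bar>"
    using norm_triangle_ineq[of x "s *\<^sub>R y"] norm_triangle_ineq4[of x "s *\<^sub>R y"] by simp_all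
  then show "((norm (x + s *\<^sub>R y))\<^sup>2 + (norm (x - s *\<^sub>R y))\<^sup>2) / 2
      \<le> ((1 + \<bar>s\<bar>)\<^sup>2 + (1 + \<bar>s\<bar>)\<^sup>2) / 2"
    by (intro divide_right_mono add_mono power_mono) simp_all
qed

text \<open>Write \<open>x = a + b\<close> and \<open>y = a - b\<close>: the coefficients of
  \<open>a\<close> add up to \<open>1\<close>, those of \<open>b\<close> to
  \<open>t - (1 - t) = - (1 - 2 * t)\<close>.\<close>

lemma combination_eq_half_diff:
  fixes x y :: "'a::real_vector"
  shows "t *\<^sub>R x + (1 - t) *\<^sub>R y = (1/2) *\<^sub>R ((x + y) - (1 - 2 * t) *\<^sub>R (x - y))"
proof -
  define a b where "a = (1/2) *\<^sub>R (x + y)" and "b = (1/2) *\<^sub>R (x - y)"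
  have "a + b = (1/2) *\<^sub>R (x + x)" "a - b = (1/2) *\<^sub>R (y + y)"
    unfolding a_def b_def scaleR_add_right[symmetric] scaleR_diff_right[symmetric] by simp_all
  then have xy: "x = a + b" "y = a - b" by simp_all
  have "t *\<^sub>R (a + b) + (1 - t) *\<^sub>R (a - b) = a - (1 - 2 * t) *\<^sub>R b"
    by (simp add: algebra_simps) (simp add: scaleR_left.add[symmetric])
  then have "t *\<^sub>R x + (1 - t) *\<^sub>R y = a - (1 - 2 * t) *\<^sub>R b"
    by (simp only: xy[symmetric])
  also have "\<dots> = (1/2) *\<^sub>R ((x + y) - (1 - 2 * t) *\<^sub>R (x - y))"
    by (simp add: a_def b_def scaleR_diff_right[of "1/2" "x + y"])
  finally show ?thesis .
qed

text \<open>Exchanging \<open>x\<close> and \<open>y\<close> in the previous identity keeps the sum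
  and reverses the sign of the difference.\<close>

lemma combination_eq_half_sum:
  fixes x y :: "'a::real_vector"
  shows "(1 - t) *\<^sub>R x + t *\<^sub>R y = (1/2) *\<^sub>R ((x + y) + (1 - 2 * t) *\<^sub>R (x - y))"
proof -
  have "(1 - t) *\<^sub>R x + t *\<^sub>R y = (1/2) *\<^sub>R ((y + x) - (1 - 2 * t) *\<^sub>R (y - x))"
    using combination_eq_half_diff[of t y x] by (simp only: add.commute)
  also have "(y + x) - (1 - 2 * t) *\<^sub>R (y - x) = (x + y) + (1 - 2 * t) *\<^sub>R (x - y)"
    by (simp only: scaleR_diff_right) (simp add: add.commute)
  finally show ?thesis .
qed

lemma L_set_eq_image_gamma_set:
  fixes t :: real
  shows "{((norm (t *\<^sub>R x + (1 - t) *\<^sub>R y))\<^sup>2 + (norm ((1 - t) *\<^sub>R x + t *\<^sub>R y))\<^sup>2)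
            / (norm (x + y))\<^sup>2
          | x y :: 'a::real_normed_vector. (x, y) \<noteq> (0, 0) \<and> x \<bottom>\<^sub>I y}
    = (*) (1/2) ` {((norm (x + (1 - 2 * t) *\<^sub>R y))\<^sup>2 + (norm (x - (1 - 2 * t) *\<^sub>R y))\<^sup>2) / 2
          | x y :: 'a. norm x = 1 \<and> norm y = 1}" (is "?L = _ ` ?G")
proof (intro equalityI subsetI)
  fix r assume "r \<in> ?L"
  then obtain x y :: 'a where nz: "(x, y) \<noteq> (0, 0)" and orth: "x \<bottom>\<^sub>I y"
    and r: "r = ((norm (t *\<^sub>R x + (1 - t) *\<^sub>R y))\<^sup>2 + (norm ((1 - t) *\<^sub>R x + t *\<^sub>R y))\<^sup>2)
            / (norm (x + y))\<^sup>2"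
    by blast
  \<comment> \<open>By orthogonality \<open>n\<close> is also the norm of \<open>x - y\<close>, so a
    single scalar normalises both vectors.\<close>
  define n where "n = norm (x + y)"
  define u v where "u = (1 / n) *\<^sub>R (x + y)" and "v = (1 / n) *\<^sub>R (x - y)"
  have n': "norm (x - y) = n"
    using orth by (simp add: isosceles_orthogonal_def n_def)
  have "n \<noteq> 0"
  proof
    assume "n = 0"
    then have "x + y = 0" "x = y" using n' by (simp_all add: n_def)
    then have "2 *\<^sub>R x = 0" by (simp add: scaleR_2)
    with \<open>x = y\<close> nz show False by simp
  qed
  then have "n > 0" by (simp add: n_def)
  have uv: "norm u = 1" "norm v = 1"
    using \<open>n > 0\<close> n' by (simp_all add: u_def v_def n_def[symmetric])
  have "x + y = n *\<^sub>R u" "x - y = n *\<^sub>R v"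
    using \<open>n > 0\<close> by (simp_all add: u_def v_def)
  then have "t *\<^sub>R x + (1 - t) *\<^sub>R y = (n / 2) *\<^sub>R (u - (1 - 2 * t) *\<^sub>R v)"
       "(1 - t) *\<^sub>R x + t *\<^sub>R y = (n / 2) *\<^sub>R (u + (1 - 2 * t) *\<^sub>R v)"
    by (simp_all only: combination_eq_half_diff combination_eq_half_sum)
      (simp_all add: scaleR_diff_right scaleR_add_right mult.commute)
  then have norms: "norm (t *\<^sub>R x + (1 - t) *\<^sub>R y) = n / 2 * norm (u - (1 - 2 * t) *\<^sub>R v)"
       "norm ((1 - t) *\<^sub>R x + t *\<^sub>R y) = n / 2 * norm (u + (1 - 2 * t) *\<^sub>R v)"
    using \<open>n > 0\<close> by simp_all
  \<comment> \<open>Each squared norm contributes \<open>(n / 2)\<^sup>2\<close>; dividing by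
    \<open>n\<^sup>2\<close> leaves \<open>1/4\<close>, split as \<open>1/2\<close> times the
    \<open>1/2\<close> in the gamma quotient.\<close>
  have "r = 1/2 * (((norm (u + (1 - 2 * t) *\<^sub>R v))\<^sup>2 + (norm (u - (1 - 2 * t) *\<^sub>R v))\<^sup>2) / 2)"
    unfolding r norms n_def[symmetric] power_mult_distrib power_divide
    using \<open>n > 0\<close> by (simp add: field_simps)
  with uv show "r \<in> (*) (1/2) ` ?G" by blast
next
  fix r assume "r \<in> (*) (1/2) ` ?G"
  then obtain u v :: 'a where uv: "norm u = 1" "norm v = 1"
    and r: "r = 1/2 * (((norm (u + (1 - 2 * t) *\<^sub>R v))\<^sup>2 + (norm (u - (1 - 2 * t) *\<^sub>R v))\<^sup>2) / 2)"
    by blast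
  \<comment> \<open>These invert the substitution, so \<open>x + y\<close> and \<open>x - y\<close>
    are the given unit vectors, and orthogonality is the equality of their norms.\<close>
  define x y where "x = (1/2) *\<^sub>R (u + v)" and "y = (1/2) *\<^sub>R (u - v)"
  have "x + y = (1/2) *\<^sub>R (u + u)" "x - y = (1/2) *\<^sub>R (v + v)"
    unfolding x_def y_def scaleR_add_right[symmetric] scaleR_diff_right[symmetric] by simp_all
  then have sum: "x + y = u" and diff: "x - y = v" by simp_all
  have "t *\<^sub>R x + (1 - t) *\<^sub>R y = (1/2) *\<^sub>R (u - (1 - 2 * t) *\<^sub>R v)"
       "(1 - t) *\<^sub>R x + t *\<^sub>R y = (1/2) *\<^sub>R (u + (1 - 2 * t) *\<^sub>R v)"
    by (simp_all only: combination_eq_half_diff combination_eq_half_sum sum diff)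
  then have "r = ((norm (t *\<^sub>R x + (1 - t) *\<^sub>R y))\<^sup>2 + (norm ((1 - t) *\<^sub>R x + t *\<^sub>R y))\<^sup>2)
            / (norm (x + y))\<^sup>2"
    by (simp add: r sum uv power_divide)
  moreover have "(x, y) \<noteq> (0, 0)" using sum uv by auto
  moreover have "x \<bottom>\<^sub>I y" by (simp add: isosceles_orthogonal_def sum diff uv)
  ultimately show "r \<in> ?L" by blast
qed

theorem theorem3:
  fixes t :: real
  assumes dim_ge_2: "\<exists>B :: 'a::banach set. independent B \<and> finite B \<and> card B = 2"
    and "0 \<le> t" and "t < 1/2"
  shows "L_const TYPE('a) t = 1/2 * gamma_const TYPE('a) (1 - 2 * t)"
proof -
  let ?G = "{((norm (x + (1 - 2 * t) *\<^sub>R y))\<^sup>2 + (norm (x - (1 - 2 * t) *\<^sub>R y))\<^sup>2) / 2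
          | x y :: 'a. norm x = 1 \<and> norm y = 1}"
  obtain B :: "'a set" where "independent B" "card B = 2" using dim_ge_2 by blast
  \<comment> \<open>Normalising a nonzero \<open>b\<close> gives a unit vector that can serve as
    both \<open>x\<close> and \<open>y\<close> in \<open>?G\<close>.\<close>
  then obtain b where "b \<in> B" "b \<noteq> 0"
    by (metis card.empty dependent_zero ex_in_conv zero_neq_numeral)
  then have "norm (sgn b) = 1" by (simp add: norm_sgn)
  then have "?G \<noteq> {}" by blast
  \<comment> \<open>A monotone continuous map commutes with \<open>Sup\<close> on a nonempty set
    that is bounded above.\<close>
  then have "Sup ((*) (1/2) ` ?G) = 1/2 * Sup ?G"
    by (intro continuous_at_Sup_mono[symmetric] bdd_above_gamma_set)
      (auto intro!: monoI continuous_intros)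
  then show ?thesis
    unfolding L_const_def gamma_const_def L_set_eq_image_gamma_set .
qed

end
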